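(* Let $W_1(x)=\frac1N\bigl\langle\mathrm{tr}\frac{1}{x-H}\bigr\rangle$ be the normalized one-loop correlation function of the generalized Laguerre ensemble of $N\times N$ matrices with weight $\det(H)\,e^{-N\mathrm{tr}H}$. Introduce its $1/N$-expansion $W_1(x)=\sum_{r=0,1/2,1,3/2,\dots}N^{-2r}W_1^{(r)}(x)$ and expand each term as $$W_1^{(r)}(x)=\sum_{n=0}^\infty C_n^{(r)}x^{-1-n-2r}.$$ Set $C_n^{(r)}=0$ whenever $r<0$ or $n<0$. Then for all integers $n$ and all $r\in\frac12\mathbb Z$, $$\begin{aligned}&(n+1)\bigl(2C^{(r)}_{n-2r}+C^{(r-1/2)}_{n-2r+1}\bigr)-4(2n-1)\bigl(C^{(r)}_{n-2r-1}+C^{(r-1/2)}_{n-2r}\bigr)\\&-(n-1)(n-2)(n-3)\bigl(2C^{(r-1)}_{n-2r}+C^{(r-3/2)}_{n-2r+1}\bigr)-(n+1)(n-1)C^{(r-1)}_{n-2r+1}\\&+(n-1)(n-2)(n-3)^2 C^{(r-2)}_{n-2r+1}=2\delta_{r,0}\delta_{n,0}+\delta_{r,1/2}\delta_{n,0}+2\delta_{r,1/2}\delta_{n,1}+2\delta_{r,1}\delta_{n,1}.\end{aligned}$$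
   Context: The generalized Laguerre ensemble with weight $\det(H)e^{-N\mathrm{tr}H}$: the eigenvalues $\lambda_1,\dots,\lambda_N\in[0,\infty)$ of the positive-definite Hermitian $N\times N$ matrix $H$ have joint probability density proportional to $\prod_{i<j}(\lambda_i-\lambda_j)^2\prod_i\lambda_i e^{-N\lambda_i}$; $\langle\cdot\rangle$ is the expectation. $W_1(x)$ is understood as the formal series $\sum_{j\ge0}m_j(N)x^{-j-1}$ with $m_j(N)=\frac1N\langle\mathrm{tr}\,H^j\rangle$. Each $m_j(N)$ is a polynomial of degree at most $j$ in $1/N$, and the $1/N$-expansion means collecting powers of $1/N$ in the $m_j(N)$: thus $C^{(r)}_{n}$ is the coefficient of $N^{-2r}$ in $m_{n+2r}(N)$. The symbols $\delta$ are Kronecker deltas. *)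

theory Defs
  imports
    "HOL-Probability.Probability"
    "HOL-Computational_Algebra.Formal_Power_Series"
    "Jordan_Normal_Form.Schur_Decomposition"
begin

definition mat_trace :: "'a :: comm_monoid_add mat \<Rightarrow> 'a" where
  "mat_trace A = (\<Sum>i<dim_row A. A $$ (i, i))"

definition hermitian_pos_def :: "nat \<Rightarrow> complex mat \<Rightarrow> bool" where
  "hermitian_pos_def N A \<longleftrightarrow>
     A \<in> carrier_mat N N \<and> mat_adjoint A = A \<and>
     (\<forall>v\<in>carrier_vec N. v \<noteq> 0\<^sub>v N \<longrightarrow> 0 < Re ((A *\<^sub>v v) \<bullet>c v))"

definition laguerre_weight :: "nat \<Rightarrow> (nat \<Rightarrow> real) \<Rightarrow> real" where
  "laguerre_weight N x =
     (\<Prod>j<N. \<Prod>i<j. (x i - x j)\<^sup>2) *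
     (\<Prod>i<N. if 0 \<le> x i then x i * exp (- real N * x i) else 0)"

text \<open>
  A random matrix \<open>H\<close> on the probability space \<open>M\<close> is drawn from the \<open>N \<times> N\<close> ensemble if it is
  Hermitian and positive definite and its eigenvalues, listed with multiplicity as
  \<open>lam \<omega> 0, \<dots>, lam \<omega> (N - 1)\<close>, have joint density proportional to the weight. Since \<open>M\<close> is a
  probability space, the constant \<open>c\<close> is determined. The weight is symmetric, so the
  labelling of the eigenvalues is exchangeable (it is not the increasing one).
\<close>

definition laguerre_ensemble :: "nat \<Rightarrow> 'a measure \<Rightarrow> ('a \<Rightarrow> complex mat) \<Rightarrow> bool" where
  "laguerre_ensemble N M H \<longleftrightarrow>
     prob_space M \<and>
     (\<forall>\<omega>\<in>space M. hermitian_pos_def N (H \<omega>)) \<and>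
     (\<forall>i<N. \<forall>j<N. (\<lambda>\<omega>. H \<omega> $$ (i, j)) \<in> borel_measurable M) \<and>
     (\<exists>lam :: 'a \<Rightarrow> nat \<Rightarrow> real. \<exists>c > 0.
        (\<forall>\<omega>\<in>space M. char_poly (H \<omega>) = (\<Prod>i<N. [:- complex_of_real (lam \<omega> i), 1:])) \<and>
        distributed M (PiM {..<N} (\<lambda>_. lborel)) lam (\<lambda>x. ennreal (c * laguerre_weight N x)))"

definition moment :: "nat \<Rightarrow> 'a measure \<Rightarrow> ('a \<Rightarrow> complex mat) \<Rightarrow> nat \<Rightarrow> complex" where
  "moment N M H j = 1 / of_nat N * (LINT \<omega>|M. mat_trace (H \<omega> ^\<^sub>m j))"

text \<open>\<open>W\<^sub>1(x)\<close>, as a formal power series in the variable \<open>1/x\<close>.\<close>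

definition W1 :: "nat \<Rightarrow> 'a measure \<Rightarrow> ('a \<Rightarrow> complex mat) \<Rightarrow> complex fps" where
  "W1 N M H = fps_X * Abs_fps (moment N M H)"

text \<open>
  The coefficient of \<open>N\<^sup>-\<^sup>s\<close> in a quantity \<open>f N\<close> that is a polynomial in \<open>1/N\<close> for all \<open>N \<ge> 1\<close>;
  the polynomial is unique because its values at infinitely many points are prescribed.
\<close>

definition inverse_N_coeff :: "(nat \<Rightarrow> complex) \<Rightarrow> nat \<Rightarrow> complex" where
  "inverse_N_coeff f s =
     Polynomial.coeff (THE p. \<forall>N\<ge>1. f N = poly p (1 / of_nat N)) s"

text \<open>
  \<open>W\<^sub>1\<^sup>(\<^sup>r\<^sup>)(x)\<close> for \<open>r = 0, 1/2, 1, \<dots>\<close>, again as a formal power series in \<open>1/x\<close>: the coefficient of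
  \<open>N\<close> to the power \<open>-2r\<close> in \<open>W\<^sub>1(x)\<close>. Below, \<open>r\<close> is only used when \<open>2 * r\<close> is an integer.
\<close>

definition W1_term ::
    "(nat \<Rightarrow> 'a measure) \<Rightarrow> (nat \<Rightarrow> 'a \<Rightarrow> complex mat) \<Rightarrow> rat \<Rightarrow> complex fps" where
  "W1_term M H r =
     Abs_fps (\<lambda>k. inverse_N_coeff (\<lambda>N. fps_nth (W1 N (M N) (H N)) k) (nat \<lfloor>2 * r\<rfloor>))"

definition C_coeff ::
    "(nat \<Rightarrow> 'a measure) \<Rightarrow> (nat \<Rightarrow> 'a \<Rightarrow> complex mat) \<Rightarrow> rat \<Rightarrow> int \<Rightarrow> complex" where
  "C_coeff M H r n =
     (if r < 0 \<or> n < 0 then 0 else fps_nth (W1_term M H r) (nat (1 + n + \<lfloor>2 * r\<rfloor>)))"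

end

theory Submission
  imports Defs
begin

text \<open>
  Let \<open>p\<^sub>l\<close> be the monic orthogonal polynomials for the weight \<open>x e\<^sup>-\<^sup>N\<^sup>x\<close>. Writing the Vandermonde
  determinant as \<open>det (p\<^sub>i(x\<^sub>j))\<close>, orthogonality collapses the average of \<open>tr H\<^sup>k\<close> to the sum over
  \<open>l < N\<close> of the diagonal matrix elements of \<open>x\<^sup>k\<close>. Integrating the Laguerre equation by parts gives a
  three-term recurrence in \<open>k\<close> for each of these (Kramers' relation). The sum over \<open>l\<close> telescopes into
  two neighbouring matrix elements with the same \<open>l\<close>, hence inherits a three-term recurrence, that of
  Haagerup and Thorbjoernsen: with \<open>u = 1/N\<close> and \<open>m\<^sub>k\<close> the normalized moments, \<open>R\<^sub>n = 0\<close> for \<open>n \<ge> 2\<close>, where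
  \<open>R\<^sub>n = (n + 1) m\<^sub>n - (2n - 1)(2 + u) m\<^sub>n\<^sub>-\<^sub>1 - n(n - 2)\<^sup>2 u\<^sup>2 m\<^sub>n\<^sub>-\<^sub>2\<close>. The stated relation is the
  coefficient extraction of \<open>(2 + u) R\<^sub>n - (n - 2) u\<^sup>2 R\<^sub>n\<^sub>-\<^sub>1 = 0\<close>.
\<close>

lemma X_pderiv_X_power: "[:0, 1:] * pderiv ([:0, 1::real:] ^ j) = Polynomial.smult (real j) ([:0, 1:] ^ j)"
proof (cases j)
  case (Suc i)
  have "pderiv [:0, 1::real:] = 1"
    by (simp add: pderiv_pCons)
  then show ?thesis
    unfolding Suc pderiv_power_Suc by (simp only: mult_1_right mult_smult_right power_Suc)
qed simp

subsection \<open>Laguerre functionals\<close>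

text \<open>The abstract form of \<open>L(f) = \<integral>\<^sub>0\<^sup>\<infinity> f(x) x e\<^sup>-\<^sup>t\<^sup>x dx\<close>; the law \<open>ibp\<close> says that the
  integral of the derivative of \<open>x\<^sup>2 e\<^sup>-\<^sup>t\<^sup>x f(x)\<close> vanishes.\<close>

locale laguerre_functional =
  fixes L :: "real poly \<Rightarrow> real" and t :: real
  assumes add: "L (p + q) = L p + L q"
    and smult: "L (Polynomial.smult c p) = c * L p"
    and ibp: "L ([:0, 1:] * pderiv p) = L ([:-2, t:] * p)"
    and t_pos: "t > 0"
begin

lemma diff: "L (p - q) = L p - L q"
  using add[of p "Polynomial.smult (-1) q"] smult[of "-1" q] by simp

text \<open>Apply \<open>ibp\<close> to \<open>pderiv p * q\<close>; after the differential equation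
  is inserted, the \<open>[:-2, t:]\<close> terms cancel. The form that remains on the right is
  symmetric in \<open>p\<close> and \<open>q\<close>, which is what orthogonality needs.\<close>

lemma sturm_liouville_symmetric:
  assumes "[:0, 1:] * pderiv (pderiv p) = [:-2, t:] * pderiv p - Polynomial.smult a p"
  shows "a * L (p * q) = L ([:0, 1:] * pderiv p * pderiv q)"
proof -
  have "L ([:0, 1:] * pderiv (pderiv p * q)) = L ([:-2, t:] * (pderiv p * q))"
    by (rule ibp)
  moreover have "[:0, 1:] * pderiv (pderiv p * q) =
      [:0, 1:] * pderiv (pderiv p) * q + [:0, 1:] * pderiv p * pderiv q"
    unfolding pderiv_mult by (simp only: algebra_simps)
  ultimately have "L ([:-2, t:] * (pderiv p * q) - Polynomial.smult a (p * q)) + L ([:0, 1:] * pderiv p * pderiv q)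
      = L ([:-2, t:] * (pderiv p * q))"
    unfolding assms add[symmetric] by (simp only: left_diff_distrib mult_smult_left mult.assoc)
  then show ?thesis by (simp add: diff smult)
qed

text \<open>The symmetric form in \<open>sturm_liouville_symmetric\<close> equals both
  \<open>a * L (p * q)\<close> and \<open>b * L (p * q)\<close>.\<close>

lemma orthogonal_eigenfunctions:
  assumes "[:0, 1:] * pderiv (pderiv p) = [:-2, t:] * pderiv p - Polynomial.smult a p"
    and "[:0, 1:] * pderiv (pderiv q) = [:-2, t:] * pderiv q - Polynomial.smult b q"
    and "a \<noteq> b"
  shows "L (p * q) = 0"
proof -
  have "a * L (p * q) = b * L (q * p)"
    unfolding sturm_liouville_symmetric[OF assms(1)] sturm_liouville_symmetric[OF assms(2)]
    by (simp only: mult_ac)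
  with assms(3) show ?thesis by (simp add: mult.commute)
qed

text \<open>Integrating by parts with \<open>X ^ j\<close> times \<open>p * p\<close>,
  \<open>p * p'\<close> and \<open>p' * p'\<close> gives three linear relations among
  \<open>U\<close>, \<open>V\<close>, \<open>W\<close>, since the differential equation removes
  second derivatives. Eliminating \<open>W\<close> and then \<open>V\<close> leaves \<open>U\<close>
  alone.\<close>

lemma diagonal_moments:
  fixes p :: "real poly" and l :: nat
  assumes ode: "[:0, 1:] * pderiv (pderiv p) = [:-2, t:] * pderiv p - Polynomial.smult (t * real l) p"
  defines "U \<equiv> \<lambda>j. L ([:0, 1:] ^ j * p * p)"
  shows "t * U 1 = (2 * real l + 2) * U 0"
    and "(real j + 2) * t\<^sup>2 * U (j + 2) = (2 * real j + 3) * (2 * real l + 2) * t * U (j + 1)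
           + (real j + 2) * (real j + 1) * real j * U j"
proof -
  define X where "X = [:0, 1::real:]"
  define p' where "p' = pderiv p"
  define V where "V = (\<lambda>j. L (X ^ j * p * p'))"
  define W where "W = (\<lambda>j. L (X ^ j * p' * p'))"
  have two: "Polynomial.smult 2 q = q + q" for q :: "real poly"
    using smult_add_left[of 1 1 q] by simp
  have lin: "[:-2, t:] * q = Polynomial.smult t (X * q) - Polynomial.smult 2 q" for q
    by (simp add: X_def algebra_simps)
  have ode': "X * pderiv p' = Polynomial.smult t (X * p') - Polynomial.smult 2 p' - Polynomial.smult (t * real l) p"
    using ode by (simp only: lin flip: X_def p'_def)
  have dX: "X * pderiv (X ^ j * f) = Polynomial.smult (real j) (X ^ j * f) + X ^ j * (X * pderiv f)" for j f
  proof -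
    have "X * pderiv (X ^ j * f) = f * (X * pderiv (X ^ j)) + X ^ j * (X * pderiv f)"
      unfolding pderiv_mult by (simp only: algebra_simps)
    also have "X * pderiv (X ^ j) = Polynomial.smult (real j) (X ^ j)"
      unfolding X_def by (rule X_pderiv_X_power)
    finally show ?thesis by (simp add: mult.commute)
  qed
  note simps = add diff smult algebra_simps power_Suc mult_smult_left mult_smult_right smult_add_right smult_diff_right
  have ibp': "real j * L (X ^ j * f) + L (X ^ j * (X * pderiv f)) = t * L (X ^ Suc j * f) - 2 * L (X ^ j * f)"
    for j f
    using ibp[of "X ^ j * f"] unfolding lin X_def[symmetric] dX
    by (simp add: add diff smult mult_ac)
  have V: "2 * V (Suc j) = t * U (Suc j) - (real j + 2) * U j" for j
  proof -
    have "X * pderiv (p * p) = Polynomial.smult 2 (X * p * p')"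
      unfolding p'_def pderiv_mult two by (simp only: algebra_simps)
    with ibp'[of j "p * p"] show ?thesis
      unfolding V_def U_def X_def[symmetric] by (simp add: simps)
  qed
  have W: "W (Suc j) = t * real l * U j - real j * V j" for j
  proof -
    have "X * pderiv (p * p') = X * p' * p' + p * (X * pderiv p')"
      unfolding p'_def pderiv_mult by (simp only: algebra_simps)
    also have "\<dots> = X * p' * p' + (Polynomial.smult t (X * p * p') - Polynomial.smult 2 (p * p') - Polynomial.smult (t * real l) (p * p))"
      unfolding ode' by (simp add: algebra_simps)
    finally have eq: "X * pderiv (p * p') = \<dots>" .
    show ?thesis using ibp'[of j "p * p'", unfolded eq]
      unfolding V_def U_def W_def X_def[symmetric] by (simp add: simps)
  qed
  have tW: "t * W (Suc j) = (2 - real j) * W j + 2 * t * real l * V j" for j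
  proof -
    have "X * pderiv (p' * p') = Polynomial.smult 2 (p' * (X * pderiv p'))"
      unfolding pderiv_mult two by (simp only: algebra_simps)
    also have "\<dots> = Polynomial.smult (2 * t) (X * p' * p') - Polynomial.smult 4 (p' * p') - Polynomial.smult (2 * t * real l) (p * p')"
      unfolding ode' by (simp add: algebra_simps smult_diff_right smult_add_right)
    finally have eq: "X * pderiv (p' * p') = \<dots>" .
    show ?thesis using ibp'[of j "p' * p'", unfolded eq]
      unfolding V_def U_def W_def X_def[symmetric] by (simp add: simps)
  qed
  show "t * U 1 = (2 * real l + 2) * U 0"
  proof -
    have "t * (t * U 1) = t * ((2 * real l + 2) * U 0)"
    proof -
      \<comment> \<open>Two expressions for \<open>t * W 2\<close> are equated: one from
        \<open>W\<close> at 1, the other from \<open>tW\<close> at 1 with \<open>W 1\<close>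
        replaced by \<open>W\<close> at 0.\<close>
      have "t * (t * real l * U 1 - V 1) = t * real l * U 0 + 2 * t * real l * V 1"
        using W[of 0] W[of 1] tW[of 1] by simp
      then have *: "2 * t * t * real l * U 1 - t * (1 + 2 * real l) * (2 * V 1) - 2 * t * real l * U 0 = 0"
        by (simp add: algebra_simps)
      have "2 * V 1 = t * U 1 - 2 * U 0"
        using V[of 0] by simp
      from *[unfolded this] show ?thesis by (simp add: algebra_simps)
    qed
    with t_pos show ?thesis by simp
  qed
  show "(real j + 2) * t\<^sup>2 * U (j + 2) = (2 * real j + 3) * (2 * real l + 2) * t * U (j + 1)
           + (real j + 2) * (real j + 1) * real j * U j"
  proof -
    \<comment> \<open>The same elimination, now for \<open>t * W (j + 3)\<close>.\<close>
    have "t * (t * real l * U (j + 2) - (real j + 2) * V (j + 2)) =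
        - real j * (t * real l * U (j + 1) - (real j + 1) * V (j + 1)) + 2 * t * real l * V (j + 2)"
      using W[of "Suc j"] W[of "Suc (Suc j)"] tW[of "Suc (Suc j)"] by (simp add: add.commute)
    then have *: "2 * t\<^sup>2 * real l * U (j + 2) - t * (real j + 2 + 2 * real l) * (2 * V (j + 2))
        + 2 * real j * t * real l * U (j + 1) - real j * (real j + 1) * (2 * V (j + 1)) = 0"
      by (simp add: algebra_simps power2_eq_square)
    have V2: "2 * V (j + 2) = t * U (j + 2) - (real j + 3) * U (j + 1)"
      and V1: "2 * V (j + 1) = t * U (j + 1) - (real j + 2) * U j"
      using V[of j] V[of "Suc j"] by (simp_all add: algebra_simps)
    from *[unfolded V1 V2] show ?thesis by (simp add: algebra_simps power2_eq_square)
  qed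
qed

end

subsection \<open>The Kramers and Haagerup-Thorbjoernsen recurrences\<close>

text \<open>\<open>kramers l k\<close> is the diagonal matrix element \<open>t\<^sup>k L(x\<^sup>k p\<^sub>l\<^sup>2) / L(p\<^sub>l\<^sup>2)\<close>, which does not depend on \<open>t\<close>.\<close>

fun kramers :: "nat \<Rightarrow> nat \<Rightarrow> real" where
  "kramers l 0 = 1"
| "kramers l (Suc 0) = 2 * real l + 2"
| "kramers l (Suc (Suc k)) = (2 * real k + 3) * (2 * real l + 2) / (real k + 2) * kramers l (Suc k)
     + (real k + 1) * real k * kramers l k"

lemma kramers_Suc_Suc:
  "(real k + 2) * kramers l (Suc (Suc k)) = (2 * real k + 3) * (2 * real l + 2) * kramers l (Suc k)
     + (real k + 2) * (real k + 1) * real k * kramers l k"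
  by (simp add: field_simps)

declare kramers.simps(3) [simp del]

lemma (in laguerre_functional) diagonal_moment_eq_kramers:
  assumes "[:0, 1:] * pderiv (pderiv p) = [:-2, t:] * pderiv p - Polynomial.smult (t * real l) p"
  shows "t ^ k * L ([:0, 1:] ^ k * p * p) = kramers l k * L (p * p)"
proof (induction k rule: less_induct)
  case (less k)
  consider "k = 0" | "k = Suc 0" | j where "k = Suc (Suc j)"
    by (metis not0_implies_Suc)
  then show ?case
  proof cases
    case 2
    then show ?thesis using diagonal_moments(1)[OF assms] by simp
  next
    case 3
    let ?U = "\<lambda>j. L ([:0, 1:] ^ j * p * p)"
    have "(real j + 2) * (t ^ k * ?U k) = t ^ j * ((real j + 2) * t\<^sup>2 * ?U (j + 2))"
      by (simp add: 3 power2_eq_square mult_ac)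
    also have "\<dots> = (2 * real j + 3) * (2 * real l + 2) * (t ^ Suc j * ?U (Suc j))
        + (real j + 2) * (real j + 1) * real j * (t ^ j * ?U j)"
      unfolding diagonal_moments(2)[OF assms] Suc_eq_plus1 by (simp add: algebra_simps)
    also have "\<dots> = (real j + 2) * (kramers l k * L (p * p))"
      using less.IH[of j] less.IH[of "Suc j"] 3
      by (simp only: mult.assoc[symmetric] kramers_Suc_Suc) (simp add: algebra_simps)
    finally show ?thesis by simp
  qed simp
qed

text \<open>This will be the ensemble average of the trace of the \<open>k\<close>-th power of
  \<open>N * H\<close>.\<close>

definition kramers_sum :: "nat \<Rightarrow> nat \<Rightarrow> real" where
  "kramers_sum N k = (\<Sum>l<N. kramers l k)"

text \<open>By the lemmas below, \<open>e k\<close> turns out to be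
  \<open>2 * k * kramers_sum l k\<close>. This is thus the Haagerup-Thorbjoernsen recurrence for
  \<open>kramers_sum l\<close>, multiplied by \<open>2 * (k + 1) * (k + 2)\<close>, but obtained
  from a single \<open>l\<close>.\<close>

lemma kramers_lower:
  fixes l :: nat
  defines "e \<equiv> \<lambda>k. kramers l (Suc k) - (2 * real l + 2 + real k) * kramers l k"
  shows "(real k + 1) * (real k + 3) * e (Suc (Suc k)) =
      (real k + 2) * (2 * real k + 3) * (2 * real l + 1) * e (Suc k)
      + (real k + 1) * (real k + 2)\<^sup>2 * real k * e k"
proof -
  let ?r = "\<lambda>k. (real k + 2) * kramers l (Suc (Suc k)) - ((2 * real k + 3) * (2 * real l + 2) * kramers l (Suc k)
     + (real k + 2) * (real k + 1) * real k * kramers l k)"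
  \<comment> \<open>The multipliers of the two residuals \<open>?r\<close> come from comparing the
    coefficients of \<open>kramers l (k + 3)\<close> and of \<open>kramers l k\<close>.\<close>
  have "(real k + 1) * (real k + 3) * e (Suc (Suc k)) - (
      (real k + 2) * (2 * real k + 3) * (2 * real l + 1) * e (Suc k)
      + (real k + 1) * (real k + 2)\<^sup>2 * real k * e k) =
      (real k + 1) * ?r (Suc k) + (- (real k + 2) * (2 * real l + real k + 2)) * ?r k"
    unfolding e_def by (simp add: algebra_simps power2_eq_square)
  moreover have "?r k = 0" for k
    using kramers_Suc_Suc[of k l] by simp
  ultimately show ?thesis by (simp only: mult_zero_right add_0_left right_minus_eq)
qed

text \<open>The companion for the sum that includes \<open>l\<close>: \<open>f k\<close> will be
  \<open>2 * k * kramers_sum (Suc l) k\<close>, so \<open>2 * l + 1\<close> becomes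
  \<open>2 * l + 3\<close>.\<close>

lemma kramers_upper:
  fixes l :: nat
  defines "f \<equiv> \<lambda>k. kramers l (Suc k) - (2 * real l + 2 - real k) * kramers l k"
  shows "(real k + 1) * (real k + 3) * f (Suc (Suc k)) =
      (real k + 2) * (2 * real k + 3) * (2 * real l + 3) * f (Suc k)
      + (real k + 1) * (real k + 2)\<^sup>2 * real k * f k"
proof -
  let ?r = "\<lambda>k. (real k + 2) * kramers l (Suc (Suc k)) - ((2 * real k + 3) * (2 * real l + 2) * kramers l (Suc k)
     + (real k + 2) * (real k + 1) * real k * kramers l k)"
  have "(real k + 1) * (real k + 3) * f (Suc (Suc k)) - (
      (real k + 2) * (2 * real k + 3) * (2 * real l + 3) * f (Suc k)
      + (real k + 1) * (real k + 2)\<^sup>2 * real k * f k) =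
      (real k + 1) * ?r (Suc k) + ((real k + 2) * (real k - 2 - 2 * real l)) * ?r k"
    unfolding f_def by (simp add: algebra_simps power2_eq_square)
  moreover have "?r k = 0" for k
    using kramers_Suc_Suc[of k l] by simp
  ultimately show ?thesis by (simp only: mult_zero_right add_0_left right_minus_eq)
qed

text \<open>Both sides are \<open>2k\<close> times the sum of \<open>kramers j k\<close> over \<open>j \<le> l\<close>; they satisfy the same
  recurrence in \<open>k\<close>.\<close>

lemma kramers_shift:
  "kramers (Suc l) (Suc k) - (2 * real l + 4 + real k) * kramers (Suc l) k
   = kramers l (Suc k) - (2 * real l + 2 - real k) * kramers l k"
proof (induction k rule: less_induct)
  case (less k)
  consider "k = 0" | "k = Suc 0" | j where "k = Suc (Suc j)"
    by (metis not0_implies_Suc)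
  then show ?case
  proof cases
    case 2
    then show ?thesis by (simp add: kramers.simps(3) field_simps)
  next
    case 3
    let ?e = "\<lambda>k. kramers (Suc l) (Suc k) - (2 * real l + 4 + real k) * kramers (Suc l) k"
    let ?f = "\<lambda>k. kramers l (Suc k) - (2 * real l + 2 - real k) * kramers l k"
    have "(real j + 1) * (real j + 3) * ?e (Suc (Suc j)) =
        (real j + 2) * (2 * real j + 3) * (2 * real l + 3) * ?e (Suc j)
        + (real j + 1) * (real j + 2)\<^sup>2 * real j * ?e j"
      using kramers_lower[of j "Suc l"] by (simp add: add_ac)
    also have "\<dots> = (real j + 1) * (real j + 3) * ?f (Suc (Suc j))"
      unfolding kramers_upper[of j l] using less.IH[of j] less.IH[of "Suc j"] 3 by simp
    finally have "(real j + 1) * (real j + 3) * ?e (Suc (Suc j)) = (real j + 1) * (real j + 3) * ?f (Suc (Suc j))" .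
    with 3 show ?thesis by simp
  qed simp
qed

text \<open>Telescoping: the expressions of \<open>kramers_upper\<close> and
  \<open>kramers_lower\<close> at the same index differ by \<open>2 * k * kramers l k\<close>, and
  \<open>kramers_shift\<close> identifies the lower one at \<open>Suc l\<close> with the upper one
  at \<open>l\<close>.\<close>

lemma kramers_sum_eq:
  "2 * real k * kramers_sum (Suc l) k = kramers l (Suc k) - (2 * real l + 2 - real k) * kramers l k"
proof (induction l)
  case 0
  \<comment> \<open>Behind this ratio is \<open>kramers 0 k = fact (k + 1)\<close>, the moments of
    the bare weight.\<close>
  have "kramers 0 (Suc k) = (real k + 2) * kramers 0 k"
  proof (induction k)
    case (Suc k)
    have "(real k + 2) * kramers 0 (Suc (Suc k)) = (real k + 2) * ((real (Suc k) + 2) * kramers 0 (Suc k))"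
      unfolding kramers_Suc_Suc by (simp add: Suc algebra_simps power2_eq_square)
    then show ?case by simp
  qed simp
  then show ?case by (simp add: kramers_sum_def algebra_simps)
next
  case (Suc l)
  then have "2 * real k * kramers_sum (Suc (Suc l)) k
    = kramers l (Suc k) - (2 * real l + 2 - real k) * kramers l k + 2 * real k * kramers (Suc l) k"
    by (simp add: kramers_sum_def algebra_simps)
  then show ?case using kramers_shift[of l k] by (simp add: algebra_simps)
qed

lemma kramers_sum_0: "kramers_sum N 0 = real N"
  by (simp add: kramers_sum_def)

lemma kramers_sum_1: "kramers_sum N (Suc 0) = real N * (real N + 1)"
  by (induction N) (auto simp: kramers_sum_def algebra_simps)

text \<open>With \<open>N = Suc l\<close>, insert \<open>kramers_sum_eq\<close> into
  \<open>kramers_upper\<close> and cancel \<open>2 * (k + 1) * (k + 2)\<close>, which is nonzero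
  even for \<open>k = 0\<close>.\<close>

lemma haagerup_thorbjornsen_recurrence:
  "(real k + 3) * kramers_sum N (Suc (Suc k)) =
    (2 * real k + 3) * (2 * real N + 1) * kramers_sum N (Suc k)
    + (real k)\<^sup>2 * (real k + 2) * kramers_sum N k"
proof (cases N)
  case 0
  then show ?thesis by (simp add: kramers_sum_def)
next
  case (Suc l)
  have "2 * (real k + 1) * (real k + 2) * ((real k + 3) * kramers_sum N (Suc (Suc k))) =
    2 * (real k + 1) * (real k + 2) * ((2 * real k + 3) * (2 * real N + 1) * kramers_sum N (Suc k)
    + (real k)\<^sup>2 * (real k + 2) * kramers_sum N k)"
    using kramers_upper[of k l] unfolding kramers_sum_eq[of _ l, symmetric] Suc
    by (simp add: algebra_simps power2_eq_square)
  then show ?thesis by simp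
qed

subsection \<open>Orthogonal polynomials for the weight \<open>x e\<^sup>-\<^sup>t\<^sup>x\<close>\<close>

definition lag_density :: "real \<Rightarrow> real \<Rightarrow> real" where
  "lag_density t x = (if 0 \<le> x then x * exp (- t * x) else 0)"

definition lag_int :: "real \<Rightarrow> real poly \<Rightarrow> real" where
  "lag_int t p = (LINT x|lborel. poly p x * lag_density t x)"

text \<open>Up to the factor \<open>t\<^sup>2\<close> the weight is the Erlang density of shape 2,
  whose moments are known.\<close>

lemma has_bochner_integral_power_lag_density:
  assumes "t > 0"
  shows "has_bochner_integral lborel (\<lambda>x. x ^ k * lag_density t x) (fact (Suc k) / t ^ (k + 2))"
proof -
  have "has_bochner_integral lborel (\<lambda>x. erlang_density 1 t x * x ^ k) (fact (1 + k) / (fact 1 * t ^ k))"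
  proof (rule has_bochner_integral_nn_integral)
    show "AE x in lborel. 0 \<le> erlang_density 1 t x * x ^ k"
      using assms by (auto simp: erlang_density_def)
  qed (use assms nn_integral_erlang_ith_moment[of t 1 k] in auto)
  then have "has_bochner_integral lborel (\<lambda>x. (1 / t\<^sup>2) * (erlang_density 1 t x * x ^ k))
      ((1 / t\<^sup>2) * (fact (1 + k) / (fact 1 * t ^ k)))"
    by (rule has_bochner_integral_mult_right)
  moreover have "(1 / t\<^sup>2) * (erlang_density 1 t x * x ^ k) = x ^ k * lag_density t x" for x
    using assms by (simp add: erlang_density_def lag_density_def power2_eq_square)
  moreover have "(1 / t\<^sup>2) * (fact (1 + k) / (fact 1 * t ^ k)) = fact (Suc k) / t ^ (k + 2)"
    by (simp add: power_add power2_eq_square mult.commute)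
  ultimately show ?thesis by (simp only:)
qed

lemma integrable_poly_lag_density:
  assumes "t > 0"
  shows "integrable lborel (\<lambda>x. poly p x * lag_density t x)"
proof -
  have "integrable lborel (\<lambda>x. coeff p i * (x ^ i * lag_density t x))" for i
    using has_bochner_integral_power_lag_density[OF assms, of i]
    by (auto simp: has_bochner_integral_iff)
  then show ?thesis
    by (simp add: poly_altdef sum_distrib_right mult.assoc)
qed

lemma lag_int_monom:
  assumes "t > 0"
  shows "lag_int t (Polynomial.monom a k) = a * (fact (Suc k) / t ^ (k + 2))"
  using has_bochner_integral_integral_eq[OF has_bochner_integral_power_lag_density[OF assms, of k]]
  by (simp add: lag_int_def poly_monom mult.assoc)

lemma lag_int_add: "t > 0 \<Longrightarrow> lag_int t (p + q) = lag_int t p + lag_int t q"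
  using integrable_poly_lag_density[of t p] integrable_poly_lag_density[of t q]
  by (simp add: lag_int_def distrib_right)

lemma lag_int_smult: "lag_int t (Polynomial.smult c p) = c * lag_int t p"
  by (simp add: lag_int_def mult.assoc)

text \<open>By linearity \<open>ibp\<close> need only hold on monomials, where it reduces to
  \<open>k = (k + 2) - 2\<close> between explicit factorial moments.\<close>

lemma laguerre_functional_lag_int:
  assumes t: "t > 0"
  shows "laguerre_functional (lag_int t) t"
proof
  show "lag_int t ([:0, 1:] * pderiv p) = lag_int t ([:-2, t:] * p)" for p
  proof -
    have mon: "lag_int t ([:0, 1:] * pderiv (Polynomial.monom a k)) = lag_int t ([:-2, t:] * Polynomial.monom a k)"
      for a k
    proof -
      have "[:0, 1:] * pderiv (Polynomial.monom a k) = Polynomial.monom (real k * a) k"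
        by (cases k) (simp_all add: pderiv_monom flip: monom_Suc)
      moreover have "[:-2, t:] * Polynomial.monom a k = Polynomial.monom (-2 * a) k + Polynomial.monom (t * a) (Suc k)"
        by (simp add: smult_monom monom_Suc)
      ultimately show ?thesis
        using t by (simp add: lag_int_add lag_int_monom field_simps)
    qed
    have "lag_int t ([:0, 1:] * pderiv (\<Sum>i\<le>n. Polynomial.monom (coeff p i) i)) =
        lag_int t ([:-2, t:] * (\<Sum>i\<le>n. Polynomial.monom (coeff p i) i))" for n
      by (induction n) (simp_all only: sum.atMost_Suc pderiv_add distrib_left lag_int_add[OF t] mon atMost_0 sum.insert
          finite.emptyI sum.empty add_0_right empty_iff not_False_eq_True)
    from this[of "degree p"] show ?thesis
      unfolding poly_as_sum_of_monoms .
  qed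
qed (use t in \<open>auto simp: lag_int_add lag_int_smult\<close>)

text \<open>Coefficients of the associated Laguerre polynomial with parameter 1, rescaled to be monic.\<close>

definition lag_coeff :: "real \<Rightarrow> nat \<Rightarrow> nat \<Rightarrow> real" where
  "lag_coeff t l j = real (l choose j) * fact (Suc l) / fact (Suc j) * (- t) ^ j / (- t) ^ l"

definition lag_poly :: "real \<Rightarrow> nat \<Rightarrow> real poly" where
  "lag_poly t l = (\<Sum>j\<le>l. Polynomial.monom (lag_coeff t l j) j)"

lemma coeff_lag_poly: "coeff (lag_poly t l) j = lag_coeff t l j"
  by (auto simp: lag_poly_def coeff_sum lag_coeff_def)

text \<open>This is the Laguerre equation compared at the coefficient of
  \<open>x ^ j\<close>.\<close>

lemma lag_coeff_Suc:
  "(real j + 1) * (real j + 2) * lag_coeff t l (Suc j) = t * (real j - real l) * lag_coeff t l j"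
proof -
  have "(real j + 1) * real (l choose Suc j) = (real l - real j) * real (l choose j)"
    using gbinomial_mult_1[of "real l" j] by (simp add: binomial_gbinomial algebra_simps)
  moreover define K where "K = fact (Suc l) / fact (Suc j) * (- t) ^ j / (- t) ^ l"
  have "(real j + 2) * lag_coeff t l (Suc j) = - t * real (l choose Suc j) * K"
  proof -
    have "(fact (Suc (Suc j)) :: real) = (real j + 2) * fact (Suc j)"
      by simp
    then show ?thesis
      by (simp add: lag_coeff_def K_def del: fact_Suc)
  qed
  moreover have lc: "lag_coeff t l j = real (l choose j) * K"
    by (simp add: lag_coeff_def K_def)
  ultimately have "(real j + 1) * ((real j + 2) * lag_coeff t l (Suc j)) = - t * ((real l - real j) * real (l choose j)) * K"
    by simp
  then show ?thesis
    by (simp add: lc algebra_simps)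
qed

lemma lag_poly_ode:
  "[:0, 1:] * pderiv (pderiv (lag_poly t l)) =
     [:-2, t:] * pderiv (lag_poly t l) - Polynomial.smult (t * real l) (lag_poly t l)"
proof (rule poly_eqI)
  fix j
  show "coeff ([:0, 1:] * pderiv (pderiv (lag_poly t l))) j =
     coeff ([:-2, t:] * pderiv (lag_poly t l) - Polynomial.smult (t * real l) (lag_poly t l)) j"
    using lag_coeff_Suc[of j t l]
    by (cases j) (auto simp: coeff_pCons coeff_pderiv coeff_lag_poly algebra_simps)
qed

lemma lag_poly_monic:
  shows "t \<noteq> 0 \<Longrightarrow> coeff (lag_poly t l) l = 1" and "j > l \<Longrightarrow> coeff (lag_poly t l) j = 0"
  by (auto simp: coeff_lag_poly lag_coeff_def)

text \<open>Distinct degrees have distinct eigenvalues \<open>t * i\<close> and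
  \<open>t * j\<close>.\<close>

lemma lag_poly_orthogonal:
  assumes "t > 0" "i \<noteq> j"
  shows "lag_int t (lag_poly t i * lag_poly t j) = 0"
  using assms by (intro laguerre_functional.orthogonal_eigenfunctions
      [OF laguerre_functional_lag_int lag_poly_ode lag_poly_ode]) auto

subsection \<open>Integration against the eigenvalue density\<close>

lemma det_monic_polys:
  fixes x :: "nat \<Rightarrow> real" and p :: "nat \<Rightarrow> real poly"
  assumes monic: "\<And>i. coeff (p i) i = 1" and deg: "\<And>i j. j > i \<Longrightarrow> coeff (p i) j = 0"
  shows "det (mat N N (\<lambda>(j, i). poly (p i) (x j))) = (\<Prod>j<N. \<Prod>i<j. x j - x i)"
proof -
  define V where "V = mat N N (\<lambda>(j, k). x j ^ k)"
  \<comment> \<open>Passing from one monic basis to another is a unipotent triangular change, so the determinant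
      may be computed in the Newton basis of the nodes, where the matrix is triangular.\<close>
  have change: "det (mat N N (\<lambda>(j, i). poly (q i) (x j))) = det V"
    if monic: "\<And>i. coeff (q i) i = 1" and deg: "\<And>i j. j > i \<Longrightarrow> coeff (q i) j = 0" for q
  proof -
    define T where "T = mat N N (\<lambda>(k, i). coeff (q i) k)"
    have "poly (q i) y = (\<Sum>k = 0..<N. y ^ k * coeff (q i) k)" if "i < N" for i y
    proof -
      have "degree (q i) < N"
        using deg[of i] that by (meson le_less_trans degree_le)
      then have "poly (q i) y = (\<Sum>k<N. coeff (q i) k * y ^ k)"
        unfolding poly_altdef by (intro sum.mono_neutral_left) (auto intro: coeff_eq_0)
      then show ?thesis by (simp add: atLeast0LessThan mult.commute)
    qed
    then have "mat N N (\<lambda>(j, i). poly (q i) (x j)) = V * T"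
      by (intro eq_matI) (auto simp: V_def T_def scalar_prod_def)
    moreover have "det T = 1"
    proof -
      have "det T = prod_list (diag_mat T)"
        by (rule det_upper_triangular[of _ N]) (auto simp: T_def upper_triangular_def deg)
      also have "\<dots> = 1"
        unfolding prod_list_diag_prod by (rule prod.neutral) (auto simp: T_def monic)
      finally show ?thesis .
    qed
    ultimately show ?thesis
      using det_mult[of V N T] by (simp add: V_def T_def)
  qed
  define q where "q = (\<lambda>i. \<Prod>m<i. [:- x m, 1:])"
  have q_degree: "degree (q i) = i" for i
    unfolding q_def by (subst degree_prod_sum_eq) auto
  have "lead_coeff (q i) = 1" for i
    unfolding q_def by (simp add: lead_coeff_prod)
  then have "det V = det (mat N N (\<lambda>(j, i). poly (q i) (x j)))"
    using change[of q] by (simp add: q_degree coeff_eq_0)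
  also have "\<dots> = prod_list (diag_mat (mat N N (\<lambda>(j, i). poly (q i) (x j))))"
    by (rule det_lower_triangular[of N]) (auto simp: q_def poly_prod)
  also have "\<dots> = (\<Prod>j<N. \<Prod>i<j. x j - x i)"
    unfolding prod_list_diag_prod by (simp add: q_def poly_prod atLeast0LessThan)
  finally show ?thesis
    using change[of p] monic deg by simp
qed

text \<open>The squared Vandermonde product is the square of the determinant of orthogonal
  polynomials. Expanding both copies by Leibniz yields products of one-variable functions, ready for
  Fubini.\<close>

lemma laguerre_weight_eq:
  assumes "N \<ge> 1"
  shows "laguerre_weight N x = (\<Sum>\<sigma> | \<sigma> permutes {..<N}. \<Sum>\<tau> | \<tau> permutes {..<N}.
      signof \<sigma> * signof \<tau> * (\<Prod>j<N. poly (lag_poly N (\<sigma> j) * lag_poly N (\<tau> j)) (x j) * lag_density N (x j)))"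
proof -
  let ?D = "det (mat N N (\<lambda>(j, i). poly (lag_poly N i) (x j)))"
  have "?D = (\<Prod>j<N. \<Prod>i<j. x j - x i)"
    by (rule det_monic_polys) (use assms in \<open>auto simp: lag_poly_monic\<close>)
  moreover have "(\<Prod>j<N. \<Prod>i<j. (x i - x j)\<^sup>2) = (\<Prod>j<N. \<Prod>i<j. (x j - x i) * (x j - x i))"
    by (intro prod.cong refl) (simp add: power2_eq_square algebra_simps)
  ultimately have weight: "laguerre_weight N x = ?D * ?D * (\<Prod>j<N. lag_density N (x j))"
    by (simp only: laguerre_weight_def lag_density_def prod.distrib)
  have less: "\<sigma> j < N" if "\<sigma> permutes {..<N}" "j < N" for \<sigma> j
    using permutes_in_image[OF that(1), of j] that(2) by simp
  have D: "?D = (\<Sum>\<sigma> | \<sigma> permutes {..<N}. signof \<sigma> * (\<Prod>j<N. poly (lag_poly N (\<sigma> j)) (x j)))"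
    by (subst det_def'[of _ N]) (auto simp: atLeast0LessThan less intro!: sum.cong prod.cong)
  show ?thesis
    unfolding weight D sum_product sum_distrib_right
    by (intro sum.cong refl) (simp add: prod.distrib sum_distrib_left mult_ac)
qed

text \<open>Fubini turns each term of the double sum into a product of one-variable integrals.
  Orthogonality removes the terms with \<open>\<sigma> \<noteq> \<tau>\<close>; a diagonal term
  contributes the squared norms \<open>h\<close> and one Kramers factor, from variable
  \<open>m\<close>.\<close>

lemma integral_laguerre_weight_power:
  assumes N: "N \<ge> 1" and m: "m < N"
  defines "h \<equiv> \<Prod>l<N. lag_int N (lag_poly N l * lag_poly N l)"
  shows "has_bochner_integral (PiM {..<N} (\<lambda>_. lborel)) (\<lambda>x. laguerre_weight N x * x m ^ k)
           (h / real N ^ k * (\<Sum>\<sigma> | \<sigma> permutes {..<N}. kramers (\<sigma> m) k))"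
proof -
  interpret product_sigma_finite "\<lambda>_ :: nat. lborel :: real measure" ..
  have t: "real N > 0" using N by simp
  define X where "X = (\<lambda>j. if j = m then [:0, 1::real:] ^ k else 1)"
  define Q where "Q = (\<lambda>\<sigma> \<tau> j. X j * lag_poly N (\<sigma> j) * lag_poly N (\<tau> j))"
  have weight: "laguerre_weight N x * x m ^ k = (\<Sum>\<sigma> | \<sigma> permutes {..<N}. \<Sum>\<tau> | \<tau> permutes {..<N}.
      signof \<sigma> * signof \<tau> * (\<Prod>j<N. poly (Q \<sigma> \<tau> j) (x j) * lag_density N (x j)))" for x
  proof -
    have "x m ^ k = (\<Prod>j<N. poly (X j) (x j))"
    proof -
      have "(\<Prod>j<N. poly (X j) (x j)) = (\<Prod>j<N. if j = m then x m ^ k else 1)"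
        by (intro prod.cong) (auto simp: X_def poly_power)
      with m show ?thesis by simp
    qed
    then show ?thesis
      unfolding laguerre_weight_eq[OF N]
      by (simp add: Q_def sum_distrib_left prod.distrib mult_ac)
  qed
  have int: "has_bochner_integral (PiM {..<N} (\<lambda>_. lborel))
      (\<lambda>x. \<Prod>j<N. poly (Q \<sigma> \<tau> j) (x j) * lag_density N (x j)) (\<Prod>j<N. lag_int N (Q \<sigma> \<tau> j))" for \<sigma> \<tau>
    unfolding has_bochner_integral_iff
    using product_integral_prod[of "{..<N}" "\<lambda>j x. poly (Q \<sigma> \<tau> j) x * lag_density N x"]
      product_integrable_prod[of "{..<N}" "\<lambda>j x. poly (Q \<sigma> \<tau> j) x * lag_density N x"]
    by (simp add: integrable_poly_lag_density[OF t] lag_int_def)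
  have off: "(\<Prod>j<N. lag_int N (Q \<sigma> \<tau> j)) = 0"
    if "\<sigma> permutes {..<N}" "\<tau> permutes {..<N}" "\<sigma> \<noteq> \<tau>" for \<sigma> \<tau>
  proof -
    \<comment> \<open>Bijections that agree off \<open>m\<close> also agree at \<open>m\<close>, so
      distinct permutations differ at some other index; its factor carries no extra power of
      \<open>x\<close>, and orthogonality applies.\<close>
    have "\<exists>j<N. j \<noteq> m \<and> \<sigma> j \<noteq> \<tau> j"
    proof (rule ccontr)
      assume "\<not> (\<exists>j<N. j \<noteq> m \<and> \<sigma> j \<noteq> \<tau> j)"
      then have *: "\<sigma> j = \<tau> j" if "j \<noteq> m" for j
        using that permutes_not_in[OF \<open>\<sigma> permutes {..<N}\<close>, of j] permutes_not_in[OF \<open>\<tau> permutes {..<N}\<close>, of j]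
        by (cases "j < N") auto
      have "\<sigma> ` (UNIV - {m}) = \<tau> ` (UNIV - {m})"
        using * by (intro image_cong) auto
      moreover have "\<sigma> ` (UNIV - {m}) = UNIV - {\<sigma> m}" "\<tau> ` (UNIV - {m}) = UNIV - {\<tau> m}"
        using that(1,2)[THEN permutes_bij] by (simp_all add: bij_def image_set_diff)
      ultimately have "\<sigma> m = \<tau> m" by auto
      with * have "\<sigma> = \<tau>" by (metis ext)
      with that show False by simp
    qed
    then obtain j where j: "j < N" "j \<noteq> m" "\<sigma> j \<noteq> \<tau> j"
      by blast
    then have "lag_int N (Q \<sigma> \<tau> j) = 0"
      using lag_poly_orthogonal[OF t, of "\<sigma> j" "\<tau> j"] by (simp add: Q_def X_def)
    with j(1) show ?thesis by (auto intro: prod_zero)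
  qed
  have diag: "(\<Prod>j<N. lag_int N (Q \<sigma> \<sigma> j)) = h / real N ^ k * kramers (\<sigma> m) k"
    if \<sigma>: "\<sigma> permutes {..<N}" for \<sigma>
  proof -
    have "lag_int N (Q \<sigma> \<sigma> j) = lag_int N (lag_poly N (\<sigma> j) * lag_poly N (\<sigma> j)) *
        (if j = m then kramers (\<sigma> m) k / real N ^ k else 1)" for j
      using laguerre_functional.diagonal_moment_eq_kramers[OF laguerre_functional_lag_int[OF t] lag_poly_ode, of k "\<sigma> m"] t
      by (simp add: Q_def X_def divide_simps mult_ac)
    then have "(\<Prod>j<N. lag_int N (Q \<sigma> \<sigma> j)) =
        (\<Prod>j<N. lag_int N (lag_poly N (\<sigma> j) * lag_poly N (\<sigma> j))) * (kramers (\<sigma> m) k / real N ^ k)"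
      using m by (simp add: prod.distrib)
    also have "(\<Prod>j<N. lag_int N (lag_poly N (\<sigma> j) * lag_poly N (\<sigma> j))) = h"
      unfolding h_def using prod.permute[OF \<sigma>, of "\<lambda>l. lag_int N (lag_poly N l * lag_poly N l)"]
      by (simp add: o_def)
    finally show ?thesis by simp
  qed
  have "has_bochner_integral (PiM {..<N} (\<lambda>_. lborel)) (\<lambda>x. laguerre_weight N x * x m ^ k)
    (\<Sum>\<sigma> | \<sigma> permutes {..<N}. \<Sum>\<tau> | \<tau> permutes {..<N}. signof \<sigma> * signof \<tau> * (\<Prod>j<N. lag_int N (Q \<sigma> \<tau> j)))"
    unfolding weight by (intro has_bochner_integral_sum has_bochner_integral_mult_right int)
  also have "(\<Sum>\<sigma> | \<sigma> permutes {..<N}. \<Sum>\<tau> | \<tau> permutes {..<N}. signof \<sigma> * signof \<tau> * (\<Prod>j<N. lag_int N (Q \<sigma> \<tau> j)))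
    = (\<Sum>\<sigma> | \<sigma> permutes {..<N}. h / real N ^ k * kramers (\<sigma> m) k)"
  proof (rule sum.cong[OF refl], clarify)
    fix \<sigma> assume \<sigma>: "\<sigma> permutes {..<N}"
    have "(\<Sum>\<tau> | \<tau> permutes {..<N}. signof \<sigma> * signof \<tau> * (\<Prod>j<N. lag_int N (Q \<sigma> \<tau> j))) =
      (\<Sum>\<tau>\<in>{\<sigma>}. signof \<sigma> * signof \<tau> * (\<Prod>j<N. lag_int N (Q \<sigma> \<tau> j)))"
    proof (rule sum.mono_neutral_right)
      show "\<forall>\<tau>\<in>{\<tau>. \<tau> permutes {..<N}} - {\<sigma>}. signof \<sigma> * signof \<tau> * (\<Prod>j<N. lag_int N (Q \<sigma> \<tau> j)) = 0"
        using off[OF \<sigma>] by (metis DiffE insertI1 mem_Collect_eq mult_zero_right)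
    qed (use \<sigma> in \<open>auto simp: finite_permutations\<close>)
    also have "\<dots> = h / real N ^ k * kramers (\<sigma> m) k"
      using diag[OF \<sigma>] by (simp add: sign_def)
    finally show "(\<Sum>\<tau> | \<tau> permutes {..<N}. signof \<sigma> * signof \<tau> * (\<Prod>j<N. lag_int N (Q \<sigma> \<tau> j))) = h / real N ^ k * kramers (\<sigma> m) k" .
  qed
  finally show ?thesis by (simp add: sum_distrib_left)
qed

lemma integral_laguerre_weight:
  assumes N: "N \<ge> 1"
  defines "h \<equiv> \<Prod>l<N. lag_int N (lag_poly N l * lag_poly N l)"
  shows "has_bochner_integral (PiM {..<N} (\<lambda>_. lborel)) (laguerre_weight N) (h * fact N)"
  using integral_laguerre_weight_power[OF N, of 0 0] N by (simp add: h_def card_permutations)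

text \<open>For fixed \<open>\<sigma>\<close>, summing over \<open>m\<close> reindexes the full sum
  \<open>kramers_sum N k\<close>, so all \<open>fact N\<close> permutations contribute
  equally.\<close>

lemma integral_laguerre_weight_power_sum:
  assumes N: "N \<ge> 1"
  defines "h \<equiv> \<Prod>l<N. lag_int N (lag_poly N l * lag_poly N l)"
  shows "has_bochner_integral (PiM {..<N} (\<lambda>_. lborel)) (\<lambda>x. laguerre_weight N x * (\<Sum>m<N. x m ^ k))
           (h * fact N * (kramers_sum N k / real N ^ k))"
proof -
  have "has_bochner_integral (PiM {..<N} (\<lambda>_. lborel)) (\<lambda>x. \<Sum>m<N. laguerre_weight N x * x m ^ k)
      (\<Sum>m<N. h / real N ^ k * (\<Sum>\<sigma> | \<sigma> permutes {..<N}. kramers (\<sigma> m) k))"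
    unfolding h_def by (intro has_bochner_integral_sum integral_laguerre_weight_power N) auto
  also have "(\<Sum>m<N. h / real N ^ k * (\<Sum>\<sigma> | \<sigma> permutes {..<N}. kramers (\<sigma> m) k)) =
     h / real N ^ k * (\<Sum>\<sigma> | \<sigma> permutes {..<N}. \<Sum>m<N. kramers (\<sigma> m) k)"
    by (subst sum.swap) (simp add: sum_distrib_left)
  also have "\<dots> = h / real N ^ k * (\<Sum>\<sigma> | \<sigma> permutes {..<N}. kramers_sum N k)"
  proof (intro arg_cong2[of _ _ _ _ "(*)"] sum.cong refl, clarify)
    fix \<sigma> assume "\<sigma> permutes {..<N}"
    from sum.permute[OF this, of "\<lambda>l. kramers l k"]
    show "(\<Sum>m<N. kramers (\<sigma> m) k) = kramers_sum N k"
      by (simp add: kramers_sum_def o_def)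
  qed
  finally show ?thesis
    by (simp add: card_permutations sum_distrib_left mult_ac)
qed

subsection \<open>Moments of the ensemble\<close>

lemma mat_trace_mult_commute:
  fixes A B :: "'a :: comm_semiring_0 mat"
  assumes "A \<in> carrier_mat n n" "B \<in> carrier_mat n n"
  shows "mat_trace (A * B) = mat_trace (B * A)"
proof -
  have "mat_trace (A * B) = (\<Sum>i<n. \<Sum>j = 0..<n. A $$ (i, j) * B $$ (j, i))"
    using assms by (auto simp: mat_trace_def scalar_prod_def intro!: sum.cong)
  also have "\<dots> = (\<Sum>i<n. \<Sum>j = 0..<n. B $$ (i, j) * A $$ (j, i))"
    unfolding atLeast0LessThan by (subst sum.swap) (simp add: mult.commute)
  also have "\<dots> = mat_trace (B * A)"
    using assms by (auto simp: mat_trace_def scalar_prod_def intro!: sum.cong)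
  finally show ?thesis .
qed

lemma upper_triangular_pow_diag:
  fixes B :: "'a :: comm_semiring_1 mat"
  assumes B: "B \<in> carrier_mat n n" "upper_triangular B"
  shows "j \<le> i \<Longrightarrow> i < n \<Longrightarrow> (B ^\<^sub>m k) $$ (i, j) = (if j = i then (B $$ (i, i)) ^ k else 0)"
proof (induction k arbitrary: i j)
  case 0
  then show ?case using B by auto
next
  case (Suc k)
  have "(B ^\<^sub>m Suc k) $$ (i, j) = (\<Sum>l = 0..<n. (B ^\<^sub>m k) $$ (i, l) * B $$ (l, j))"
    using Suc.prems B by (simp add: scalar_prod_def)
  \<comment> \<open>For \<open>l < i\<close> the first factor vanishes by induction; for
    \<open>l > i\<close> the second does, since then \<open>l > j\<close>.\<close>
  also have "\<dots> = (\<Sum>l = 0..<n. if l = i then (B ^\<^sub>m k) $$ (i, i) * B $$ (i, j) else 0)"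
  proof (rule sum.cong[OF refl])
    fix l assume "l \<in> {0..<n}"
    then show "(B ^\<^sub>m k) $$ (i, l) * B $$ (l, j) = (if l = i then (B ^\<^sub>m k) $$ (i, i) * B $$ (i, j) else 0)"
      using Suc.IH[of l i] Suc.prems B(1) upper_triangularD[OF B(2), of j l]
      by (cases l i rule: linorder_cases) auto
  qed
  also have "\<dots> = (B ^\<^sub>m k) $$ (i, i) * B $$ (i, j)"
    using Suc.prems by simp
  finally show ?case
    using Suc.IH[of i i] Suc.prems B(1) upper_triangularD[OF B(2), of j i] by (auto simp: mult.commute)
qed

text \<open>Schur triangularization puts the \<open>e i\<close> on the diagonal of \<open>B\<close>;
  cyclicity of the trace removes the conjugation.\<close>

lemma mat_trace_pow_eq_sum_eigenvalues:
  fixes A :: "complex mat"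
  assumes A: "A \<in> carrier_mat n n" and char: "char_poly A = (\<Prod>i<n. [:- e i, 1:])"
  shows "mat_trace (A ^\<^sub>m k) = (\<Sum>i<n. e i ^ k)"
proof -
  have "char_poly A = (\<Prod>a\<leftarrow>map e [0..<n]. [:- a, 1:])"
    by (simp add: char prod.list_conv_set_nth atLeast0LessThan)
  moreover obtain B P Q where BPQ: "schur_decomposition A (map e [0..<n]) = (B, P, Q)"
    by (cases "schur_decomposition A (map e [0..<n])")
  ultimately have wit: "similar_mat_wit A B P Q" and tri: "upper_triangular B"
    and diag: "diag_mat B = map e [0..<n]"
    using schur_decomposition[OF A _ BPQ] by auto
  from similar_mat_witD2[OF A wit]
  have carrier: "B \<in> carrier_mat n n" "P \<in> carrier_mat n n" "Q \<in> carrier_mat n n" and QP: "Q * P = 1\<^sub>m n"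
    by auto
  have "mat_trace (A ^\<^sub>m k) = mat_trace (P * (B ^\<^sub>m k * Q))"
    using similar_mat_wit_pow_id[OF wit, of k] carrier by (simp add: assoc_mult_mat[of _ n n _ n _ n])
  also have "\<dots> = mat_trace (B ^\<^sub>m k * (Q * P))"
    using carrier by (subst mat_trace_mult_commute[of _ n]) (auto simp: assoc_mult_mat[of _ n n _ n _ n])
  also have "\<dots> = mat_trace (B ^\<^sub>m k)"
    using carrier by (simp add: QP)
  also have "\<dots> = (\<Sum>i<n. (B $$ (i, i)) ^ k)"
    using carrier upper_triangular_pow_diag[OF carrier(1) tri] by (simp add: mat_trace_def)
  also have "\<dots> = (\<Sum>i<n. e i ^ k)"
  proof (rule sum.cong[OF refl])
    fix i assume "i \<in> {..<n}"
    then have "B $$ (i, i) = diag_mat B ! i"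
      using carrier by (simp add: diag_mat_def)
    with diag \<open>i \<in> {..<n}\<close> show "(B $$ (i, i)) ^ k = e i ^ k" by simp
  qed
  finally show ?thesis .
qed

lemma moment_laguerre_ensemble:
  assumes ens: "laguerre_ensemble N M H" and N: "N \<ge> 1"
  shows "moment N M H k = of_real (kramers_sum N k / real N ^ Suc k)"
proof -
  define h where "h = (\<Prod>l<N. lag_int N (lag_poly N l * lag_poly N l))"
  let ?P = "PiM {..<N} (\<lambda>_. lborel) :: (nat \<Rightarrow> real) measure"
  from ens obtain lam c where "prob_space M" and c: "c > 0"
    and carrier: "\<And>\<omega>. \<omega> \<in> space M \<Longrightarrow> H \<omega> \<in> carrier_mat N N"
    and char: "\<And>\<omega>. \<omega> \<in> space M \<Longrightarrow> char_poly (H \<omega>) = (\<Prod>i<N. [:- complex_of_real (lam \<omega> i), 1:])"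
    and dist: "distributed M ?P lam (\<lambda>x. ennreal (c * laguerre_weight N x))"
    by (auto simp: laguerre_ensemble_def hermitian_pos_def_def)
  interpret prob_space M by fact
  have nonneg: "0 \<le> c * laguerre_weight N x" for x
    using c by (auto simp: laguerre_weight_def intro!: mult_nonneg_nonneg prod_nonneg)
  \<comment> \<open>Total mass 1 determines \<open>c\<close>, so the unknown norms \<open>h\<close>
    drop out of the average.\<close>
  have "1 = (LINT x|?P. c * laguerre_weight N x * 1)"
    using distributed_integral[OF dist, of "\<lambda>_. 1"] nonneg by (simp add: prob_space)
  then have norm: "c * (h * fact N) = 1"
    using has_bochner_integral_integral_eq[OF integral_laguerre_weight[OF N]] by (simp add: h_def)
  have "(LINT \<omega>|M. (\<Sum>i<N. lam \<omega> i ^ k)) = (LINT x|?P. c * laguerre_weight N x * (\<Sum>i<N. x i ^ k))"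
    by (rule distributed_integral[OF dist, symmetric]) (use nonneg in \<open>auto intro!: borel_measurable_sum borel_measurable_power\<close>)
  also have "\<dots> = c * (h * fact N) * (kramers_sum N k / real N ^ k)"
    using has_bochner_integral_integral_eq[OF integral_laguerre_weight_power_sum[OF N, of k]]
    by (simp add: h_def mult.assoc)
  also have "\<dots> = kramers_sum N k / real N ^ k"
    by (simp add: norm)
  finally have "(LINT \<omega>|M. complex_of_real (\<Sum>i<N. lam \<omega> i ^ k)) = of_real (kramers_sum N k / real N ^ k)"
    by (simp only: integral_complex_of_real)
  moreover have "(LINT \<omega>|M. mat_trace (H \<omega> ^\<^sub>m k)) = (LINT \<omega>|M. complex_of_real (\<Sum>i<N. lam \<omega> i ^ k))"
    by (rule Bochner_Integration.integral_cong[OF refl])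
      (simp add: mat_trace_pow_eq_sum_eigenvalues[OF carrier char])
  ultimately show ?thesis
    using N by (simp add: moment_def)
qed

subsection \<open>Coefficients of the expansion\<close>

text \<open>In the variable \<open>u = 1 / N\<close>, this is
  \<open>haagerup_thorbjornsen_recurrence\<close> divided by \<open>N ^ (k + 3)\<close>:
  \<open>[:2, 1:]\<close> is \<open>2 + u\<close> and \<open>[:0, 0, 1:]\<close> is
  \<open>u\<^sup>2\<close>.\<close>

fun moment_poly :: "nat \<Rightarrow> complex poly" where
  "moment_poly 0 = 1"
| "moment_poly (Suc 0) = [:1, 1:]"
| "moment_poly (Suc (Suc k)) = Polynomial.smult (1 / (of_nat k + 3))
     (Polynomial.smult (2 * of_nat k + 3) ([:2, 1:] * moment_poly (Suc k))
      + Polynomial.smult ((of_nat k)\<^sup>2 * (of_nat k + 2)) ([:0, 0, 1:] * moment_poly k))"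

lemma poly_moment_poly:
  assumes "N \<ge> 1"
  shows "poly (moment_poly k) (1 / of_nat N) = of_real (kramers_sum N k / real N ^ Suc k)"
proof (induction k rule: moment_poly.induct)
  case 1
  show ?case using assms by (simp add: kramers_sum_0)
next
  case 2
  show ?case using assms by (simp add: kramers_sum_1 field_simps)
next
  case (3 k)
  have N: "of_nat N \<noteq> (0 :: complex)" and k: "of_nat k + 3 \<noteq> (0 :: complex)"
    using assms of_nat_neq_0[of "k + 2", where 'a = complex] by (auto simp: add_ac)
  have "complex_of_real ((real k + 3) * kramers_sum N (Suc (Suc k))) =
    of_real ((2 * real k + 3) * (2 * real N + 1) * kramers_sum N (Suc k)
    + (real k)\<^sup>2 * (real k + 2) * kramers_sum N k)"
    by (simp only: haagerup_thorbjornsen_recurrence)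
  then have "complex_of_real (kramers_sum N (Suc (Suc k))) =
    ((2 * of_nat k + 3) * (2 * of_nat N + 1) * of_real (kramers_sum N (Suc k))
    + (of_nat k)\<^sup>2 * (of_nat k + 2) * of_real (kramers_sum N k)) / (of_nat k + 3)"
    using k by (simp add: eq_divide_eq mult.commute)
  moreover have "poly (moment_poly (Suc (Suc k))) (1 / of_nat N) =
     ((2 * of_nat k + 3) * (2 + 1 / of_nat N) * (of_real (kramers_sum N (Suc k)) / of_nat N ^ Suc (Suc k))
     + (of_nat k)\<^sup>2 * (of_nat k + 2) / (of_nat N)\<^sup>2 * (of_real (kramers_sum N k) / of_nat N ^ Suc k)) / (of_nat k + 3)"
  proof -
    have poly_rec: "poly (moment_poly (Suc (Suc k))) u = ((2 * of_nat k + 3) * (2 + u) * poly (moment_poly (Suc k)) u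
        + (of_nat k)\<^sup>2 * (of_nat k + 2) * u\<^sup>2 * poly (moment_poly k) u) / (of_nat k + 3)" for u
      by (simp add: algebra_simps add_divide_distrib power2_eq_square)
    show ?thesis
      unfolding poly_rec 3 by (simp add: power_divide)
  qed
  moreover have "\<dots> = (((2 * of_nat k + 3) * (2 * of_nat N + 1) * of_real (kramers_sum N (Suc k))
    + (of_nat k)\<^sup>2 * (of_nat k + 2) * of_real (kramers_sum N k)) / (of_nat k + 3)) / of_nat N ^ Suc (Suc (Suc k))"
    using N k by (simp add: divide_simps power2_eq_square)
  ultimately show ?case
    by (simp only: of_real_divide of_real_power of_real_of_nat_eq)
qed

text \<open>The coefficient of \<open>N\<^sup>-\<^sup>s\<close> in \<open>m\<^sub>k(N)\<close>, extended by zero to negative indices.\<close>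

definition moment_coeff :: "int \<Rightarrow> int \<Rightarrow> complex" where
  "moment_coeff k s = (if k < 0 \<or> s < 0 then 0 else coeff (moment_poly (nat k)) (nat s))"

lemma moment_coeff_neg: "k < 0 \<Longrightarrow> moment_coeff k s = 0"
  by (simp add: moment_coeff_def)

lemma moment_coeff_0: "moment_coeff 0 s = of_bool (s = 0)"
  by (auto simp: moment_coeff_def)

lemma moment_coeff_1: "moment_coeff 1 s = of_bool (s = 0) + of_bool (s = 1)"
  by (auto simp: moment_coeff_def coeff_pCons split: nat.splits)

text \<open>Multiplication by \<open>u\<close> shifts \<open>s\<close> by one; extension by zero
  makes the shifted terms correct for every integer \<open>s\<close>.\<close>

lemma moment_coeff_rec:
  "(of_nat k + 3) * moment_coeff (int k + 2) s =
     (2 * of_nat k + 3) * (2 * moment_coeff (int k + 1) s + moment_coeff (int k + 1) (s - 1))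
     + (of_nat k)\<^sup>2 * (of_nat k + 2) * moment_coeff (int k) (s - 2)"
proof (cases "s < 0")
  case False
  then obtain j where s: "s = int j"
    by (metis nonneg_int_cases not_less)
  have nat_simps: "nat (int k + 2) = Suc (Suc k)" "nat (int k + 1) = Suc k"
    by auto
  have k: "of_nat k + 3 \<noteq> (0 :: complex)"
    using of_nat_neq_0[of "k + 2", where 'a = complex] by (simp add: add_ac)
  have "coeff (moment_poly (Suc (Suc k))) j * (of_nat k + 3) =
    (2 * of_nat k + 3) * (2 * coeff (moment_poly (Suc k)) j + coeff (pCons 0 (moment_poly (Suc k))) j)
     + (of_nat k)\<^sup>2 * (of_nat k + 2) * coeff (pCons 0 (pCons 0 (moment_poly k))) j"
    using k by (simp del: smult_pCons)
  moreover have "coeff (pCons 0 (moment_poly (Suc k))) j = moment_coeff (int k + 1) (s - 1)"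
    by (cases j) (auto simp: s moment_coeff_def nat_simps)
  moreover have "coeff (pCons 0 (pCons 0 (moment_poly k))) j = moment_coeff (int k) (s - 2)"
  proof -
    consider "j = 0" | "j = 1" | i where "j = Suc (Suc i)"
      by (metis One_nat_def not0_implies_Suc)
    then show ?thesis
      by cases (auto simp: s moment_coeff_def)
  qed
  ultimately show ?thesis
    by (simp add: s moment_coeff_def nat_simps mult.commute)
qed (simp add: moment_coeff_def)

text \<open>This degree bound reconciles \<open>moment_coeff\<close> with the convention that
  \<open>C_coeff\<close> vanishes at negative \<open>n\<close>.\<close>

lemma moment_coeff_degree:
  "s > int k \<Longrightarrow> moment_coeff (int k) s = 0"
proof (induction k arbitrary: s rule: moment_poly.induct)
  case (3 k)
  have "of_nat k + 3 \<noteq> (0 :: complex)"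
    using of_nat_neq_0[of "k + 2", where 'a = complex] by (simp add: add_ac)
  with 3 show ?case
    using moment_coeff_rec[of k s] by (simp add: add.commute)
qed (auto simp: moment_coeff_0 moment_coeff_1)

text \<open>Two candidates agree at the infinitely many points \<open>1 / N\<close>, hence coincide,
  so \<open>THE\<close> selects \<open>p\<close>.\<close>

lemma inverse_N_coeff_eq:
  assumes f: "\<And>N. N \<ge> 1 \<Longrightarrow> f N = poly p (1 / of_nat N)"
  shows "inverse_N_coeff f s = coeff p s"
proof -
  have "q = p" if q: "\<forall>N\<ge>1. f N = poly q (1 / of_nat N)" for q
  proof (rule ccontr)
    assume "q \<noteq> p"
    then have "finite {z. poly (q - p) z = 0}"
      by (intro poly_roots_finite) simp
    moreover have "range (\<lambda>n. 1 / of_nat (Suc n)) \<subseteq> {z. poly (q - p) z = 0}"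
    proof clarify
      fix n
      show "poly (q - p) (1 / of_nat (Suc n)) = 0"
        using f[of "Suc n"] q[rule_format, of "Suc n"] by (simp del: of_nat_Suc)
    qed
    ultimately have "finite (range (\<lambda>n. 1 / of_nat (Suc n) :: complex))"
      by (rule finite_subset[rotated])
    moreover have "inj (\<lambda>n. 1 / of_nat (Suc n) :: complex)"
      by (rule injI) (simp del: of_nat_Suc)
    ultimately show False
      using finite_imageD by blast
  qed
  with f have "(THE p. \<forall>N\<ge>1. f N = poly p (1 / of_nat N)) = p"
    by (intro the_equality) auto
  then show ?thesis
    by (simp add: inverse_N_coeff_def)
qed

lemma C_coeff_eq_moment_coeff:
  assumes ens: "\<And>N. N \<ge> 1 \<Longrightarrow> laguerre_ensemble N (M N) (H N)" and r: "2 * r = of_int s"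
  shows "C_coeff M H r (k - s) = moment_coeff k s"
proof (cases "s < 0 \<or> k - s < 0")
  case True
  have "r < 0" if "s < 0"
    using r that by (metis mult_less_0_iff of_int_less_0_iff zero_less_numeral not_less_iff_gr_or_eq)
  moreover have "moment_coeff k s = 0" if "s \<ge> 0" "k < s"
    using that moment_coeff_degree[of "nat k" s] by (cases "k < 0") (auto simp: moment_coeff_def)
  ultimately show ?thesis
    using True by (auto simp: C_coeff_def moment_coeff_def)
next
  case False
  have "\<not> r < 0"
    using r False by (metis mult_pos_neg not_less_iff_gr_or_eq of_int_less_0_iff zero_less_numeral)
  have floor: "\<lfloor>2 * r\<rfloor> = s"
    by (simp add: r)
  \<comment> \<open>The extra 1 is the factor \<open>fps_X\<close> in \<open>W1\<close>: moment
    \<open>k\<close> sits at exponent \<open>k + 1\<close>.\<close>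
  have "nat (1 + (k - s) + s) = Suc (nat k)"
    using False by auto
  then have "C_coeff M H r (k - s) =
      inverse_N_coeff (\<lambda>N. moment N (M N) (H N) (nat k)) (nat s)"
    using False \<open>\<not> r < 0\<close> by (simp add: C_coeff_def floor W1_term_def W1_def)
  also have "\<dots> = coeff (moment_poly (nat k)) (nat s)"
    by (rule inverse_N_coeff_eq) (simp only: poly_moment_poly moment_laguerre_ensemble[OF ens])
  finally show ?thesis
    using False by (simp add: moment_coeff_def)
qed

lemma moment_coeff_five_term:
  "(of_int n + 1) * (2 * moment_coeff n s + moment_coeff n (s - 1))
     - 4 * (2 * of_int n - 1) * (moment_coeff (n - 1) s + moment_coeff (n - 1) (s - 1))
     - (of_int n - 1) * (of_int n - 2) * (of_int n - 3)
         * (2 * moment_coeff (n - 2) (s - 2) + moment_coeff (n - 2) (s - 3))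
     - (of_int n + 1) * (of_int n - 1) * moment_coeff (n - 1) (s - 2)
     + (of_int n - 1) * (of_int n - 2) * (of_int n - 3)\<^sup>2 * moment_coeff (n - 3) (s - 4)
     = 2 * of_bool (s = 0) * of_bool (n = 0) + of_bool (s = 1) * of_bool (n = 0)
       + 2 * of_bool (s = 1) * of_bool (n = 1) + 2 * of_bool (s = 2) * of_bool (n = 1)"
  (is "?L n = ?R n")
proof -
  consider "n < 0" | "n = 0" | "n = 1" | "n = 2" | k where "n = int k + 3"
  proof -
    have "\<exists>k. n = int k + 3" if "n \<ge> 3"
      using that by (intro exI[of _ "nat (n - 3)"]) simp
    then show ?thesis using that by fastforce
  qed
  then show ?thesis
  proof cases
    case 1
    then show ?thesis by (simp add: moment_coeff_neg)
  next
    \<comment> \<open>The deltas arise for \<open>n = 0\<close> and \<open>n = 1\<close>, from the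
      initial moments 1 and \<open>1 + u\<close>: the left-hand sides are \<open>2 + u\<close> and
      \<open>2 * u * (1 + u)\<close>.\<close>
    case 2
    then show ?thesis by (simp add: moment_coeff_neg moment_coeff_0)
  next
    case 3
    then show ?thesis by (auto simp: moment_coeff_neg moment_coeff_0 moment_coeff_1)
  next
    case 4
    then show ?thesis
      using moment_coeff_rec[of 0 s] moment_coeff_rec[of 0 "s - 1"] by (simp add: algebra_simps)
  next
    case (5 k)
    define R where "R = (\<lambda>k s. (of_nat k + 3) * moment_coeff (int k + 2) s -
     ((2 * of_nat k + 3) * (2 * moment_coeff (int k + 1) s + moment_coeff (int k + 1) (s - 1))
     + (of_nat k)\<^sup>2 * (of_nat k + 2) * moment_coeff (int k) (s - 2)))"
    have "R k s = 0" for k s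
      using moment_coeff_rec[of k s] by (simp add: R_def)
    \<comment> \<open>Here \<open>R (Suc k)\<close> and \<open>R k\<close> belong to
      \<open>n\<close> and \<open>n - 1\<close>, and \<open>k + 1 = n - 2\<close>. The
      \<open>u\<^sup>2\<close> part of \<open>(2 + u)\<^sup>2\<close> combines with the subtracted
      relation to give the coefficient \<open>(n + 1) * (n - 1)\<close>.\<close>
    moreover have "?L n = 2 * R (Suc k) s + R (Suc k) (s - 1) - (of_nat k + 1) * R k (s - 2)"
      unfolding R_def 5 by (simp add: algebra_simps power2_eq_square)
    ultimately show ?thesis
      by (simp add: 5)
  qed
qed

theorem corollary2:
  fixes M :: "nat \<Rightarrow> 'a measure" and H :: "nat \<Rightarrow> 'a \<Rightarrow> complex mat"
    and C :: "rat \<Rightarrow> int \<Rightarrow> complex" and n s :: int and r :: rat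
  assumes "\<And>N. N \<ge> 1 \<Longrightarrow> laguerre_ensemble N (M N) (H N)"
    and "C = C_coeff M H"
    and "2 * r = of_int s"
  shows
    "(of_int n + 1) * (2 * C r (n - s) + C (r - 1/2) (n - s + 1))
     - 4 * (2 * of_int n - 1) * (C r (n - s - 1) + C (r - 1/2) (n - s))
     - (of_int n - 1) * (of_int n - 2) * (of_int n - 3)
         * (2 * C (r - 1) (n - s) + C (r - 3/2) (n - s + 1))
     - (of_int n + 1) * (of_int n - 1) * C (r - 1) (n - s + 1)
     + (of_int n - 1) * (of_int n - 2) * (of_int n - 3)\<^sup>2 * C (r - 2) (n - s + 1)
     = 2 * of_bool (r = 0) * of_bool (n = 0) + of_bool (r = 1/2) * of_bool (n = 0)
       + 2 * of_bool (r = 1/2) * of_bool (n = 1) + 2 * of_bool (r = 1) * of_bool (n = 1)"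
proof -
  \<comment> \<open>Lowering \<open>r\<close> by \<open>i / 2\<close> lowers the power of
    \<open>1 / N\<close> by \<open>i\<close>; adding it to the index \<open>j\<close> recovers the
    moment.\<close>
  have C: "C (r - of_int i / 2) j = moment_coeff (j + (s - i)) (s - i)" for i j
    using C_coeff_eq_moment_coeff[OF assms(1), where r = "r - of_int i / 2" and s = "s - i" and k = "j + (s - i)"]
    by (simp add: assms(2,3) right_diff_distrib)
  have r: "r = 0 \<longleftrightarrow> s = 0" "r = 1/2 \<longleftrightarrow> s = 1" "r = 1 \<longleftrightarrow> s = 2"
    using assms(3) by linarith+
  show ?thesis
    using C[of 0] C[of 1] C[of 2] C[of 3] C[of 4] moment_coeff_five_term[of n s]
    unfolding r by (simp add: algebra_simps)
qed

end
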